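(* Let $n,r\in\mathbb N$. Then $$\operatorname{Radon}_{\ell_\infty^{2^{2nr}}}(2n,r)\ge1.$$
   Context: $\ell_\infty^N$ is $\mathbb R^N$ with the maximum norm. For a Banach space $X$ and pairwise disjoint sets $Z_1,\dots,Z_r\subset X$, each of cardinality $2n$, put $S=\bigcup_{j=1}^r Z_j$ and $D=\max_j\operatorname{diam}Z_j$. A balanced Radon split is a partition $S=Q_0\sqcup Q_1$ with $|Q_0\cap Z_j|=|Q_1\cap Z_j|=n$ for all $j$. Then $\operatorname{Radon}_X(2n,r)=\sup_{Z_1,\dots,Z_r}\inf_{S=Q_0\sqcup Q_1}\frac{\operatorname{dist}(\operatorname{conv}Q_0,\operatorname{conv}Q_1)}{D}$, the infimum over all balanced Radon splits, where $\operatorname{dist}(A,B)=\inf\{\|a-b\|:a\in A,b\in B\}$. *)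

theory Defs
  imports "HOL-Analysis.Analysis"
begin

text \<open>
  The Banach space \<open>X\<close> is given as a complete linear subspace of a normed space
  (\<open>X = UNIV\<close> for a type of class \<open>banach\<close>), so that its dimension may be a term.
\<close>

definition radon_families :: "'a::real_normed_vector set \<Rightarrow> nat \<Rightarrow> nat \<Rightarrow> (nat \<Rightarrow> 'a set) set" where
  "radon_families X m r =
     {Z. (\<forall>j\<in>{1..r}. Z j \<subseteq> X \<and> finite (Z j) \<and> card (Z j) = m) \<and> disjoint_family_on Z {1..r}}"

definition max_diam :: "(nat \<Rightarrow> 'a::real_normed_vector set) \<Rightarrow> nat \<Rightarrow> real" where
  "max_diam Z r = Max ((\<lambda>j. diameter (Z j)) ` {1..r})"

definition balanced_splits ::
    "(nat \<Rightarrow> 'a set) \<Rightarrow> nat \<Rightarrow> nat \<Rightarrow> ('a set \<times> 'a set) set" where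
  "balanced_splits Z m r =
     {(Q0, Q1). Q0 \<union> Q1 = (\<Union>j\<in>{1..r}. Z j) \<and> Q0 \<inter> Q1 = {} \<and>
        (\<forall>j\<in>{1..r}. card (Q0 \<inter> Z j) = m div 2 \<and> card (Q1 \<inter> Z j) = m div 2)}"

text \<open>
  Meant for even \<open>m \<ge> 2\<close> and \<open>r \<ge> 1\<close>; then \<open>max_diam Z r > 0\<close> for every admissible family.
  The values are taken in \<open>ereal\<close> so that supremum and infimum always exist.
\<close>

definition radon :: "'a::real_normed_vector set \<Rightarrow> nat \<Rightarrow> nat \<Rightarrow> ereal" where
  "radon X m r =
     (SUP Z\<in>radon_families X m r. INF (Q0, Q1)\<in>balanced_splits Z m r.
        ereal (setdist (convex hull Q0) (convex hull Q1) / max_diam Z r))"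

text \<open>
  Every function on the discrete space \<open>nat\<close> is continuous, so \<open>nat \<Rightarrow>\<^sub>C real\<close> is the space of
  bounded real sequences with the supremum norm; \<open>linf N\<close> consists of those supported on the
  first \<open>N\<close> coordinates. The lemmas below identify it with \<open>\<real>\<^sup>N\<close> under the maximum norm.
\<close>

definition linf :: "nat \<Rightarrow> (nat \<Rightarrow>\<^sub>C real) set" where
  "linf N = {x. \<forall>i\<ge>N. apply_bcontfun x i = 0}"

lemma subspace_linf: "subspace (linf N)"
  by (auto simp: subspace_def linf_def)

lemma linf_ex1: "\<exists>!x. x \<in> linf N \<and> (\<forall>i<N. apply_bcontfun x i = f i)"
proof -
  define g where "g = (\<lambda>i. if i < N then f i else (0::real))"
  have "range g \<subseteq> insert 0 (f ` {..<N})" by (auto simp: g_def)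
  then have "bounded (range g)"
    using bounded_subset finite_imp_bounded by (metis finite_imageI finite_insert finite_lessThan)
  then have "g \<in> bcontfun"
    by (simp add: bcontfun_def)
  then have g: "apply_bcontfun (Bcontfun g) = g"
    by (rule Bcontfun_inverse)
  show ?thesis
  proof (rule ex1I[of _ "Bcontfun g"])
    show "Bcontfun g \<in> linf N \<and> (\<forall>i<N. apply_bcontfun (Bcontfun g) i = f i)"
      by (simp add: g linf_def) (simp add: g_def)
  next
    fix x assume "x \<in> linf N \<and> (\<forall>i<N. apply_bcontfun x i = f i)"
    then show "x = Bcontfun g"
      by (intro bcontfun_eqI) (auto simp: g linf_def, auto simp: g_def)
  qed
qed

lemma norm_linf:
  assumes "x \<in> linf N" "N > 0"
  shows "norm x = Max ((\<lambda>i. \<bar>apply_bcontfun x i\<bar>) ` {..<N})"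
proof (rule antisym)
  have "\<bar>apply_bcontfun x i\<bar> \<le> Max ((\<lambda>i. \<bar>apply_bcontfun x i\<bar>) ` {..<N})" for i
  proof (cases "i < N")
    case True
    then show ?thesis by (intro Max_ge) auto
  next
    case False
    then have "\<bar>apply_bcontfun x i\<bar> \<le> \<bar>apply_bcontfun x 0\<bar>"
      using assms by (simp add: linf_def)
    also have "\<dots> \<le> Max ((\<lambda>i. \<bar>apply_bcontfun x i\<bar>) ` {..<N})"
      using assms by (intro Max_ge) auto
    finally show ?thesis .
  qed
  then show "norm x \<le> Max ((\<lambda>i. \<bar>apply_bcontfun x i\<bar>) ` {..<N})"
    by (intro norm_bound) auto
  show "Max ((\<lambda>i. \<bar>apply_bcontfun x i\<bar>) ` {..<N}) \<le> norm x"
    using assms norm_bounded[of x] by (intro Max.boundedI) auto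
qed

lemma complete_linf: "complete (linf N)"
proof (rule completeI)
  fix f :: "nat \<Rightarrow> nat \<Rightarrow>\<^sub>C real"
  assume f: "\<forall>n. f n \<in> linf N" and "Cauchy f"
  have "Cauchy (\<lambda>n. apply_bcontfun (f n) i)" for i
  proof (rule metric_CauchyI)
    fix e :: real assume "e > 0"
    then obtain M where "\<forall>m\<ge>M. \<forall>n\<ge>M. dist (f m) (f n) < e"
      using metric_CauchyD[OF \<open>Cauchy f\<close>] by blast
    then show "\<exists>M. \<forall>m\<ge>M. \<forall>n\<ge>M. dist (apply_bcontfun (f m) i) (apply_bcontfun (f n) i) < e"
      by (intro exI[of _ M] allI impI le_less_trans[OF dist_bounded]) auto
  qed
  then have "\<forall>i. \<exists>l. (\<lambda>n. apply_bcontfun (f n) i) \<longlonglongrightarrow> l"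
    using Cauchy_convergent convergent_def by blast
  then obtain l where l: "(\<lambda>n. apply_bcontfun (f n) i) \<longlonglongrightarrow> l i" for i
    by metis
  obtain x where x: "x \<in> linf N" "\<And>i. i < N \<Longrightarrow> apply_bcontfun x i = l i"
    using linf_ex1[of N l] by blast
  have bound: "norm (f n - x) \<le> (\<Sum>i<N. \<bar>apply_bcontfun (f n) i - l i\<bar>)" for n
  proof (rule norm_bound)
    fix i
    show "norm (apply_bcontfun (f n - x) i) \<le> (\<Sum>i<N. \<bar>apply_bcontfun (f n) i - l i\<bar>)"
    proof (cases "i < N")
      case True
      then show ?thesis
        using x(2) member_le_sum[of i "{..<N}" "\<lambda>i. \<bar>apply_bcontfun (f n) i - l i\<bar>"]
        by simp
    next
      case False
      then show ?thesis using f x(1) by (simp add: linf_def sum_nonneg)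
    qed
  qed
  have "(\<lambda>n. \<Sum>i<N. \<bar>apply_bcontfun (f n) i - l i\<bar>) \<longlonglongrightarrow> (\<Sum>i<N. \<bar>l i - l i\<bar>)"
    by (intro tendsto_sum tendsto_rabs tendsto_diff tendsto_const l)
  then have "(\<lambda>n. f n - x) \<longlonglongrightarrow> 0"
    using bound by (intro Lim_null_comparison[of "\<lambda>n. f n - x", OF always_eventually]) simp_all
  then show "\<exists>x\<in>linf N. f \<longlonglongrightarrow> x"
    using x(1) LIM_zero_cancel[of f x sequentially] by blast
qed

end

theory Submission
  imports Defs
begin

text \<open>
  Take \<open>m = 2nr\<close> points of \<open>\<ell>\<^sub>\<infinity>\<close> of dimension \<open>2\<^sup>m\<close> whose coordinates run through all
  0-1 patterns on the \<open>m\<close> points. Distinct points are at distance 1, and for every splitting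
  of the points the coordinate equal to its indicator pattern keeps the two convex hulls at
  distance at least 1, however the points are grouped into the sets \<open>Z\<^sub>j\<close>.
\<close>

lemma linf_cube_points:
  obtains x :: "nat \<Rightarrow> nat \<Rightarrow>\<^sub>C real"
  where "\<And>s. x s \<in> linf (2 ^ m)"
    and "\<And>s t. dist (x s) (x t) \<le> 1"
    and "\<And>A. A \<subseteq> {..<m} \<Longrightarrow> \<exists>i. \<forall>s. apply_bcontfun (x s) i = of_bool (s \<in> A)"
proof -
  \<comment> \<open>The dimension is the number of subsets of \<open>{..<m}\<close>, so
    \<open>e\<close> can assign one subset to each coordinate; the point \<open>x s\<close> records
    which of these subsets contain \<open>s\<close>.\<close>
  have "card {..<2 ^ m :: nat} = card (Pow {..<m})"
    by (simp add: card_Pow)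
  then obtain e :: "nat \<Rightarrow> nat set" where e: "bij_betw e {..<2 ^ m} (Pow {..<m})"
    using finite_same_card_bij by (metis finite_Pow_iff finite_lessThan)
  have "\<exists>z. z \<in> linf (2 ^ m) \<and> (\<forall>i<2 ^ m. apply_bcontfun z i = of_bool (s \<in> e i))" for s
    using linf_ex1[of "2 ^ m" "\<lambda>i. of_bool (s \<in> e i)"] by blast
  then obtain x where x: "\<And>s. x s \<in> linf (2 ^ m)"
      "\<And>s i. i < 2 ^ m \<Longrightarrow> apply_bcontfun (x s) i = of_bool (s \<in> e i)"
    by metis
  show thesis
  proof
    show "x s \<in> linf (2 ^ m)" for s by (rule x)
    show "dist (x s) (x t) \<le> 1" for s t
    proof (rule dist_bound)
      fix i
      show "dist (apply_bcontfun (x s) i) (apply_bcontfun (x t) i) \<le> 1"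
        using x(1)[of s] x(1)[of t]
        by (cases "i < 2 ^ m") (auto simp: x(2) dist_real_def linf_def)
    qed
    show "\<exists>i. \<forall>s. apply_bcontfun (x s) i = of_bool (s \<in> A)" if "A \<subseteq> {..<m}" for A
    proof -
      have "A \<in> e ` {..<2 ^ m}"
        using e that by (simp add: bij_betw_def)
      then obtain i where "i < 2 ^ m" "e i = A" by auto
      then show ?thesis using x(2) by blast
    qed
  qed
qed

text \<open>Evaluation at \<open>i\<close> is linear, so its level sets are convex and a level set
  containing \<open>S\<close> contains the hull.\<close>

lemma convex_hull_bcontfun_const:
  fixes S :: "('a::topological_space \<Rightarrow>\<^sub>C real) set"
  assumes "\<And>y. y \<in> S \<Longrightarrow> apply_bcontfun y i = c" and "y \<in> convex hull S"
  shows "apply_bcontfun y i = c"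
proof -
  have "convex {y :: 'a \<Rightarrow>\<^sub>C real. apply_bcontfun y i = c}"
    by (auto simp: convex_def plus_bcontfun.rep_eq scaleR_bcontfun.rep_eq
        simp flip: distrib_right)
  then have "convex hull S \<subseteq> {y. apply_bcontfun y i = c}"
    using assms(1) by (intro hull_minimal) auto
  then show ?thesis using assms(2) by auto
qed

text \<open>Evaluation at \<open>i\<close> is 1-Lipschitz for the supremum norm and constant on each
  hull. Nonemptiness matters because \<open>setdist\<close> with an empty set is 0.\<close>

lemma setdist_convex_hull_bcontfun_ge:
  fixes S T :: "('a::topological_space \<Rightarrow>\<^sub>C real) set"
  assumes "S \<noteq> {}" "T \<noteq> {}"
    and "\<And>y. y \<in> S \<Longrightarrow> apply_bcontfun y i = c"
    and "\<And>y. y \<in> T \<Longrightarrow> apply_bcontfun y i = d"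
  shows "setdist (convex hull S) (convex hull T) \<ge> \<bar>c - d\<bar>"
proof (rule le_setdistI)
  fix a b assume "a \<in> convex hull S" "b \<in> convex hull T"
  then have "apply_bcontfun a i = c" "apply_bcontfun b i = d"
    using convex_hull_bcontfun_const assms(3,4) by metis+
  then show "\<bar>c - d\<bar> \<le> dist a b"
    using dist_bounded[of a i b] by (simp add: dist_real_def)
qed (use assms in auto)

theorem lemma10p3:
  fixes n r :: nat
  assumes "n \<ge> 1" "r \<ge> 1"
  shows "radon (linf (2 ^ (2 * n * r))) (2 * n) r \<ge> 1"
proof -
  define m where "m = 2 * n * r"
  obtain x :: "nat \<Rightarrow> nat \<Rightarrow>\<^sub>C real" where x: "\<And>s. x s \<in> linf (2 ^ m)"
    "\<And>s t. dist (x s) (x t) \<le> 1"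
    "\<And>A. A \<subseteq> {..<m} \<Longrightarrow> \<exists>i. \<forall>s. apply_bcontfun (x s) i = of_bool (s \<in> A)"
    using linf_cube_points[of m] by blast
  \<comment> \<open>The coordinate whose pattern is \<open>{s}\<close> separates \<open>x s\<close>
    from all other points.\<close>
  have inj: "inj_on x {..<m}"
  proof (rule inj_onI)
    fix s t assume st: "s \<in> {..<m}" "t \<in> {..<m}" "x s = x t"
    with x(3)[of "{s}"] obtain i where "\<forall>u. apply_bcontfun (x u) i = of_bool (u \<in> {s})"
      by auto
    then have "of_bool (t \<in> {s}) = (of_bool (s \<in> {s}) :: real)"
      using st(3) by metis
    then show "s = t" by simp
  qed
  \<comment> \<open>Consecutive blocks of length \<open>2 * n\<close>; the shift by one is there
    because the families are numbered from 1, and the blocks for \<open>j\<close> in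
    \<open>{1..r}\<close> exhaust \<open>{..<m}\<close>.\<close>
  define I where "I j = {2 * n * (j - 1)..<2 * n * j}" for j
  define Z where "Z j = x ` I j" for j
  have I_sub: "I j \<subseteq> {..<m}" if "j \<in> {1..r}" for j
  proof -
    have "2 * n * j \<le> m" using that by (simp add: m_def)
    then show ?thesis by (auto simp: I_def)
  qed
  have card_Z: "card (Z j) = 2 * n" if "j \<in> {1..r}" for j
  proof -
    have "card (Z j) = card (I j)"
      unfolding Z_def by (intro card_image inj_on_subset[OF inj] I_sub that)
    then show ?thesis
      using that by (simp add: I_def flip: diff_mult_distrib2)
  qed
  have I_disj: "I j \<inter> I k = {}" if "j < k" for j k
  proof -
    have "2 * n * j \<le> 2 * n * (k - 1)" using that by (intro mult_le_mono2) simp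
    then show ?thesis by (auto simp: I_def)
  qed
  have disj: "disjoint_family_on Z {1..r}"
  proof (unfold disjoint_family_on_def, intro ballI impI)
    fix j k assume jk: "j \<in> {1..r}" "k \<in> {1..r}" "j \<noteq> k"
    then have "I j \<inter> I k = {}"
      using I_disj by (metis Int_commute nat_neq_iff)
    then show "Z j \<inter> Z k = {}"
      unfolding Z_def using jk inj_on_image_Int[OF inj I_sub I_sub, of j k] by simp
  qed
  have fam: "Z \<in> radon_families (linf (2 ^ m)) (2 * n) r"
    using x(1) card_Z disj by (auto simp: radon_families_def Z_def I_def)
  have diam_le: "max_diam Z r \<le> 1"
    unfolding max_diam_def using assms x(2)
    by (auto intro!: Max.boundedI diameter_le simp: Z_def simp flip: dist_norm)
  \<comment> \<open>Strict positivity excludes division by zero, which would make the quotient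
    0.\<close>
  have diam_pos: "max_diam Z r > 0"
  proof -
    have one: "1 \<in> {1..r}" using assms by simp
    have "\<not> card (Z 1) \<le> Suc 0"
      using card_Z[OF one] assms by simp
    moreover have fin: "finite (Z 1)" by (simp add: Z_def I_def)
    ultimately obtain a b where ab: "a \<in> Z 1" "b \<in> Z 1" "a \<noteq> b"
      using card_le_Suc0_iff_eq by metis
    then have "0 < dist a b" by simp
    also have "\<dots> \<le> diameter (Z 1)"
      using ab fin by (intro diameter_bounded_bound finite_imp_bounded)
    also have "\<dots> \<le> max_diam Z r"
      unfolding max_diam_def using one by (intro Max_ge) auto
    finally show ?thesis .
  qed
  have split: "1 \<le> setdist (convex hull Q0) (convex hull Q1) / max_diam Z r"
    if Q: "(Q0, Q1) \<in> balanced_splits Z (2 * n) r" for Q0 Q1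
  proof -
    have U: "Q0 \<union> Q1 = (\<Union>j\<in>{1..r}. Z j)" and D: "Q0 \<inter> Q1 = {}"
      and C: "card (Q0 \<inter> Z 1) = n" "card (Q1 \<inter> Z 1) = n"
      using Q assms by (auto simp: balanced_splits_def)
    have ne: "Q0 \<noteq> {}" "Q1 \<noteq> {}"
      using C assms by auto
    have sub: "Q0 \<union> Q1 \<subseteq> x ` {..<m}"
      unfolding U Z_def using I_sub by blast
    \<comment> \<open>The separating coordinate is the one whose pattern is the index set of
      \<open>Q0\<close>; it is 1 on \<open>Q0\<close> and, by disjointness, 0 on
      \<open>Q1\<close>.\<close>
    obtain i where i: "\<forall>s. apply_bcontfun (x s) i = of_bool (s \<in> {s. s < m \<and> x s \<in> Q0})"
      using x(3)[of "{s. s < m \<and> x s \<in> Q0}"] by auto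
    have "apply_bcontfun y i = 1" if "y \<in> Q0" for y
      using that sub i by auto
    moreover have "apply_bcontfun y i = 0" if "y \<in> Q1" for y
    proof -
      obtain s where "y = x s" using \<open>y \<in> Q1\<close> sub by auto
      moreover have "y \<notin> Q0" using \<open>y \<in> Q1\<close> D by auto
      ultimately show ?thesis using i by simp
    qed
    ultimately have "1 \<le> setdist (convex hull Q0) (convex hull Q1)"
      using setdist_convex_hull_bcontfun_ge[OF ne, of i 1 0] by simp
    \<comment> \<open>Dividing by a diameter in the interval from 0 (excluded) to 1 keeps the
      bound.\<close>
    then show ?thesis
      using diam_le diam_pos by (simp add: le_divide_eq)
  qed
  \<comment> \<open>The supremum is bounded below by the value at the single family
    \<open>Z\<close>.\<close>
  have "1 \<le> (INF (Q0, Q1)\<in>balanced_splits Z (2 * n) r.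
        ereal (setdist (convex hull Q0) (convex hull Q1) / max_diam Z r))"
    using split by (intro INF_greatest) (auto simp: one_ereal_def)
  also have "\<dots> \<le> radon (linf (2 ^ m)) (2 * n) r"
    unfolding radon_def by (rule SUP_upper[OF fam])
  finally show ?thesis by (simp add: m_def)
qed

end
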